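(* Assume that the system $x_{k+1}=F_kx_k+G_kx_kw_k$, $y_k=H_kx_k$, $k=0,1,2,\dots$, is periodic with period $\tau>0$, i.e. $F_{k+\tau}=F_k$, $G_{k+\tau}=G_k$, $H_{k+\tau}=H_k$ for all $k\ge0$. Let $N\ge0$ be any integer. If the system is $\mathcal K^{N}$-exactly observable and $\{P_k\ge 0\}_{k\ge 0}$ solves the generalized Lyapunov equation $$-P_k+F_k^TP_{k+1}F_k+G_k^TP_{k+1}G_k+H_k^TH_k=0,\qquad k=0,1,2,\dots,$$ then the periodic system is ESMS.
   Context: $\{w_k\}_{k\ge 0}$ is a one-dimensional independent white noise process on a probability space, with $E w_k=0$, $E[w_kw_j]=\delta_{kj}$; $\mathcal F_k=\sigma(w_0,\dots,w_k)$ and $\mathcal F_{-1}$ is the trivial sigma-algebra; $l^2_{\mathcal F_k}$ is the set of $\mathcal F_k$-measurable random vectors $x$ with $E\|x\|^2<\infty$. $F_k,G_k\in\mathbb R^{n\times n}$, $H_k\in\mathbb R^{m\times n}$ are deterministic real matrices; $x_k\in\mathbb R^n$, $y_k\in\mathbb R^m$. $A\ge0$ means $A$ is real symmetric positive semi-definite. A state $x_{k_0}\in l^2_{\mathcal F_{k_0-1}}$ at time $k_0$ is $k_0^{s_0}$-unobservable if the output generated from it satisfies $y_k=0$ a.s. for all $k\in[k_0,k_0+s_0]$. The system is $k_0^{s_0}$-exactly observable if $x_{k_0}=0$ (a.s.) is the unique $k_0^{s_0}$-unobservable state. For an integer $N\ge0$, the system is $\mathcal K^N$-exactly observable if it is $k^N$-exactly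 observable for every time $k\ge 0$. ESMS (exponentially stable in mean square): there exist $\beta\ge 1$ and $\lambda\in(0,1)$ such that for any $0\le k_0\le k<+\infty$ and any state $x_{k_0}\in l^2_{\mathcal F_{k_0-1}}$ at time $k_0$, the trajectory started from $x_{k_0}$ satisfies $E\|x_k\|^2\le\beta E\|x_{k_0}\|^2\lambda^{k-k_0}$. *)

theory Defs
  imports "HOL-Probability.Probability"
begin

definition white_noise :: "'a measure \<Rightarrow> (nat \<Rightarrow> 'a \<Rightarrow> real) \<Rightarrow> bool" where
  "white_noise M w \<longleftrightarrow>
     prob_space.indep_vars M (\<lambda>_. borel) w UNIV \<and>
     (\<forall>k. integrable M (\<lambda>\<omega>. (w k \<omega>)\<^sup>2)) \<and>
     (\<forall>k. (\<integral>\<omega>. w k \<omega> \<partial>M) = 0) \<and>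
     (\<forall>k j. (\<integral>\<omega>. w k \<omega> * w j \<omega> \<partial>M) = (if k = j then 1 else 0))"

text \<open>The sigma-algebra generated by \<open>w\<^sub>j\<close>, \<open>j \<le> k\<close>. The index is an integer so that
  \<open>k = -1\<close> is allowed and yields the trivial sigma-algebra.\<close>

definition noise_filtration :: "'a measure \<Rightarrow> (nat \<Rightarrow> 'a \<Rightarrow> real) \<Rightarrow> int \<Rightarrow> 'a measure" where
  "noise_filtration M w k =
     sigma (space M) (\<Union>j\<in>{j. int j \<le> k}. {w j -` A \<inter> space M | A. A \<in> sets borel})"

definition l2_adapted ::
    "'a measure \<Rightarrow> (nat \<Rightarrow> 'a \<Rightarrow> real) \<Rightarrow> int \<Rightarrow> ('a \<Rightarrow> real^'n) set" where
  "l2_adapted M w k =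
     {x. x \<in> borel_measurable (noise_filtration M w k) \<and>
         integrable M (\<lambda>\<omega>. (norm (x \<omega>))\<^sup>2)}"

text \<open>\<open>trajectory F G w k0 x0 k\<close> is the state at the absolute time \<open>k \<ge> k0\<close> when the
  state at time \<open>k0\<close> is \<open>x0\<close>. The value \<open>x0\<close> at times \<open>k < k0\<close> is a dummy.\<close>

primrec trajectory ::
    "(nat \<Rightarrow> real^'n^'n) \<Rightarrow> (nat \<Rightarrow> real^'n^'n) \<Rightarrow> (nat \<Rightarrow> 'a \<Rightarrow> real) \<Rightarrow>
     nat \<Rightarrow> ('a \<Rightarrow> real^'n) \<Rightarrow> nat \<Rightarrow> 'a \<Rightarrow> real^'n" where
  "trajectory F G w k0 x0 0 = x0"
| "trajectory F G w k0 x0 (Suc k) =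
     (if k < k0 then x0
      else (\<lambda>\<omega>. F k *v trajectory F G w k0 x0 k \<omega>
                 + w k \<omega> *\<^sub>R (G k *v trajectory F G w k0 x0 k \<omega>)))"

definition unobservable_state ::
    "'a measure \<Rightarrow> (nat \<Rightarrow> 'a \<Rightarrow> real) \<Rightarrow> (nat \<Rightarrow> real^'n^'n) \<Rightarrow> (nat \<Rightarrow> real^'n^'n) \<Rightarrow>
     (nat \<Rightarrow> real^'n^'m) \<Rightarrow> nat \<Rightarrow> nat \<Rightarrow> ('a \<Rightarrow> real^'n) \<Rightarrow> bool" where
  "unobservable_state M w F G H k0 s0 x \<longleftrightarrow>
     x \<in> l2_adapted M w (int k0 - 1) \<and>
     (\<forall>k\<in>{k0..k0+s0}. AE \<omega> in M. H k *v trajectory F G w k0 x k \<omega> = 0)"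

definition exactly_observable_at ::
    "'a measure \<Rightarrow> (nat \<Rightarrow> 'a \<Rightarrow> real) \<Rightarrow> (nat \<Rightarrow> real^'n^'n) \<Rightarrow> (nat \<Rightarrow> real^'n^'n) \<Rightarrow>
     (nat \<Rightarrow> real^'n^'m) \<Rightarrow> nat \<Rightarrow> nat \<Rightarrow> bool" where
  "exactly_observable_at M w F G H k0 s0 \<longleftrightarrow>
     (\<forall>x\<in>l2_adapted M w (int k0 - 1).
        unobservable_state M w F G H k0 s0 x \<longleftrightarrow> (AE \<omega> in M. x \<omega> = 0))"

definition K_exactly_observable ::
    "'a measure \<Rightarrow> (nat \<Rightarrow> 'a \<Rightarrow> real) \<Rightarrow> (nat \<Rightarrow> real^'n^'n) \<Rightarrow> (nat \<Rightarrow> real^'n^'n) \<Rightarrow>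
     (nat \<Rightarrow> real^'n^'m) \<Rightarrow> nat \<Rightarrow> bool" where
  "K_exactly_observable M w F G H N \<longleftrightarrow> (\<forall>k. exactly_observable_at M w F G H k N)"

text \<open>The Bochner integral of a non-integrable function is 0, so the finiteness of
  \<open>E \<parallel>x\<^sub>k\<parallel>\<^sup>2\<close> that is implicit in the estimate is stated explicitly.\<close>

definition ESMS ::
    "'a measure \<Rightarrow> (nat \<Rightarrow> 'a \<Rightarrow> real) \<Rightarrow> (nat \<Rightarrow> real^'n^'n) \<Rightarrow> (nat \<Rightarrow> real^'n^'n) \<Rightarrow> bool" where
  "ESMS M w F G \<longleftrightarrow>
     (\<exists>\<beta> \<rho>::real. 1 \<le> \<beta> \<and> 0 < \<rho> \<and> \<rho> < 1 \<and>
        (\<forall>k0 k. k0 \<le> k \<longrightarrow> (\<forall>x\<in>l2_adapted M w (int k0 - 1).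
           integrable M (\<lambda>\<omega>. (norm (trajectory F G w k0 x k \<omega>))\<^sup>2) \<and>
           (\<integral>\<omega>. (norm (trajectory F G w k0 x k \<omega>))\<^sup>2 \<partial>M)
             \<le> \<beta> * (\<integral>\<omega>. (norm (x \<omega>))\<^sup>2 \<partial>M) * \<rho> ^ (k - k0))))"

definition psd :: "real^'n^'n \<Rightarrow> bool" where
  "psd A \<longleftrightarrow> transpose A = A \<and> (\<forall>v. 0 \<le> v \<bullet> (A *v v))"

definition solves_GLE ::
    "(nat \<Rightarrow> real^'n^'n) \<Rightarrow> (nat \<Rightarrow> real^'n^'n) \<Rightarrow> (nat \<Rightarrow> real^'n^'m) \<Rightarrow>
     (nat \<Rightarrow> real^'n^'n) \<Rightarrow> bool" where
  "solves_GLE F G H P \<longleftrightarrow>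
     (\<forall>k. - P k + transpose (F k) ** P (k + 1) ** F k
            + transpose (G k) ** P (k + 1) ** G k
            + transpose (H k) ** H k = 0)"

end

theory Submission
  imports Defs
begin

text \<open>
  The past is independent of the current noise, which is centred with unit variance. Hence the mean
  of a quadratic form \<open>S\<close> in the next state equals the mean of the form
  \<open>F\<^sup>T S F + G\<^sup>T S G\<close> in the current one, and every second moment along a trajectory is the mean
  of a deterministic quadratic form in the initial state (\<open>expectation_qform_trajectory\<close>). In
  particular, the output energy over \<open>m\<close> steps is the mean of the Gramian form
  (\<open>output_energy\<close>), so the whole problem is governed by the Gramians.

  The Gramians are bounded on both sides, uniformly in the initial time. From above, the Lyapunov
  equation writes \<open>P\<^sub>k\<close> as the Gramian over \<open>m\<close> steps plus a positive semi-definite remainder, so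
  all Gramians starting at time \<open>k\<close> lie below \<open>P\<^sub>k\<close>. The sequence \<open>P\<close> itself may fail to be
  periodic or bounded, but the Gramians are periodic, so only \<open>P\<^sub>0, \<dots>, P\<^sub>\<tau>\<^sub>-\<^sub>1\<close> matter
  (\<open>periodic_gramian_upper_bound\<close>). From below, a deterministic initial state on which the Gramian
  over \<open>N + 1\<close> steps vanishes is unobservable, so exact observability makes these Gramians positive
  definite; compactness of the sphere and periodicity give a common constant.

  For \<open>a\<^sub>i = E \<parallel>x\<^sub>k\<^sub>0\<^sub>+\<^sub>i\<parallel>\<^sup>2\<close> the lower bound says that \<open>a\<^sub>i\<close> is controlled by the output energy
  in a window of length \<open>N + 1\<close> starting at \<open>i\<close>, and the upper bound that the total output energy
  after time \<open>s\<close> is controlled by \<open>a\<^sub>s\<close>. Summing the windows gives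
  \<open>a\<^sub>s + a\<^sub>s\<^sub>+\<^sub>1 + \<dots> \<le> D a\<^sub>s\<close> for all \<open>s\<close>, with \<open>D\<close> independent of the initial time and state, and a
  sequence whose tail sums are dominated by their first terms decays exponentially
  (\<open>exponential_decay_of_tail_sums_le\<close>).
\<close>

section \<open>A summability criterion for exponential decay\<close>

text \<open>A discrete form of Datko's argument. The tail sum \<open>A\<^sub>s = a\<^sub>s + a\<^sub>s\<^sub>+\<^sub>1 + \<dots>\<close> loses the
  term \<open>a\<^sub>s \<ge> A\<^sub>s / D\<close> when \<open>s\<close> increases by one, so \<open>A\<close> decays geometrically, and \<open>a \<le> A\<close>.\<close>

lemma exponential_decay_of_tail_sums_le:
  fixes a :: "nat \<Rightarrow> real" and D :: real
  assumes nonneg: "\<And>i. 0 \<le> a i"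
    and D: "1 < D"
    and tail: "\<And>s m. (\<Sum>i<m. a (s + i)) \<le> D * a s"
  shows "a s \<le> D * a 0 * (1 - 1 / D) ^ s"
proof -
  define A where "A s = (\<Sum>i. a (s + i))" for s
  have summ: "summable (\<lambda>i. a (s + i))" for s
    using nonneg tail[where s = s] by (intro summableI_nonneg_bounded[where x = "D * a s"]) auto
  have A_le: "A s \<le> D * a s" for s
    unfolding A_def using tail[where s = s] by (intro suminf_le_const summ) auto
  have A_split: "A s = a s + A (Suc s)" for s
    using suminf_split_head[OF summ, of s] by (simp add: A_def)
  have A_nonneg: "0 \<le> A s" for s
    unfolding A_def by (intro suminf_nonneg summ nonneg)
  have A_step: "A (Suc s) \<le> (1 - 1 / D) * A s" for s
  proof -
    have "A s / D \<le> a s"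
      using A_le[of s] D by (simp add: field_simps)
    then show ?thesis
      using A_split[of s] unfolding left_diff_distrib by simp
  qed
  have A_pow: "A s \<le> (1 - 1 / D) ^ s * A 0" for s
  proof (induction s)
    case (Suc s)
    have "A (Suc s) \<le> (1 - 1 / D) * A s"
      by (rule A_step)
    also have "\<dots> \<le> (1 - 1 / D) * ((1 - 1 / D) ^ s * A 0)"
      using Suc D by (intro mult_left_mono) auto
    finally show ?case
      by (simp add: mult.assoc)
  qed simp
  have "a s \<le> A s"
    using A_split[of s] A_nonneg[of "Suc s"] by linarith
  also have "\<dots> \<le> (1 - 1 / D) ^ s * A 0"
    by (rule A_pow)
  also have "\<dots> \<le> (1 - 1 / D) ^ s * (D * a 0)"
    using A_le[of 0] D by (intro mult_left_mono) auto
  finally show ?thesis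
    by (simp add: mult_ac)
qed

section \<open>Quadratic forms and the dual of the second-moment recursion\<close>

definition qform :: "real^'n^'n \<Rightarrow> real^'n \<Rightarrow> real" where
  "qform A v = v \<bullet> (A *v v)"

lemma qform_0 [simp]: "qform 0 v = 0"
  by (simp add: qform_def)

lemma qform_add: "qform (A + B) v = qform A v + qform B v"
  by (simp add: qform_def matrix_vector_mult_add_rdistrib inner_add_right)

lemma qform_sum: "qform (\<Sum>i\<in>I. A i) v = (\<Sum>i\<in>I. qform (A i) v)"
  by (induction I rule: infinite_finite_induct) (simp_all add: qform_add)

lemma qform_mat_1: "qform (mat 1) v = (norm v)\<^sup>2"
  by (simp add: qform_def power2_norm_eq_inner)

lemma inner_transpose_matrix_vector:
  fixes A :: "real^'n^'m"
  shows "v \<bullet> (transpose A *v u) = (A *v v) \<bullet> u"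
  by (simp add: dot_lmul_matrix inner_commute[of v] inner_commute[of u])

lemma qform_gram:
  fixes A :: "real^'n^'m"
  shows "qform (transpose A ** A) v = (norm (A *v v))\<^sup>2"
  unfolding qform_def power2_norm_eq_inner
  by (simp only: inner_transpose_matrix_vector matrix_vector_mul_assoc[symmetric])

lemma qform_congruence:
  fixes A :: "real^'n^'m"
  shows "qform (transpose A ** S ** A) v = qform S (A *v v)"
  unfolding qform_def
  by (simp only: inner_transpose_matrix_vector matrix_vector_mul_assoc[symmetric])

lemma continuous_on_qform [continuous_intros]: "continuous_on X (qform A)"
  unfolding qform_def
  by (intro continuous_intros linear_continuous_on matrix_vector_mul_bounded_linear)

lemma borel_measurable_qform [measurable]: "qform A \<in> borel_measurable borel"
  by (intro borel_measurable_continuous_onI continuous_on_qform)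

lemma qform_bounded: "\<exists>K>0. \<forall>v. \<bar>qform A v\<bar> \<le> K * (norm v)\<^sup>2"
proof -
  obtain K where K: "K > 0" "\<And>v. norm (A *v v) \<le> norm v * K"
    using bounded_linear.pos_bounded[OF matrix_vector_mul_bounded_linear[of A]] by auto
  have "\<bar>qform A v\<bar> \<le> K * (norm v)\<^sup>2" for v
  proof -
    have "\<bar>qform A v\<bar> \<le> norm v * norm (A *v v)"
      unfolding qform_def by (rule Cauchy_Schwarz_ineq2)
    also have "\<dots> \<le> norm v * (norm v * K)"
      using K(2) by (intro mult_left_mono) auto
    finally show ?thesis
      by (simp add: power2_eq_square mult_ac)
  qed
  with K(1) show ?thesis
    by blast
qed

text \<open>By homogeneity the minimum on the compact unit sphere serves as the constant.\<close>

lemma qform_coercive: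
  fixes A :: "real^'n^'n"
  assumes pos: "\<And>v. v \<noteq> 0 \<Longrightarrow> 0 < qform A v"
  shows "\<exists>c>0. \<forall>v. c * (norm v)\<^sup>2 \<le> qform A v"
proof -
  have "sphere (0::real^'n) 1 \<noteq> {}"
    by simp
  then obtain u where u: "u \<in> sphere 0 1" "\<And>v. v \<in> sphere 0 1 \<Longrightarrow> qform A u \<le> qform A v"
    using continuous_attains_inf[of "sphere 0 1" "qform A"] continuous_on_qform
    by (metis compact_sphere)
  have "qform A u * (norm v)\<^sup>2 \<le> qform A v" for v
  proof (cases "v = 0")
    case False
    define z where "z = v /\<^sub>R norm v"
    have v: "v = norm v *\<^sub>R z" and z: "z \<in> sphere 0 1"
      using False by (auto simp: z_def)
    have "qform A v = (norm v)\<^sup>2 * qform A z"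
      by (subst v) (simp add: qform_def matrix_vector_mult_scaleR power2_eq_square)
    with u(2)[OF z] show ?thesis
      by (simp add: mult.commute mult_right_mono)
  qed (simp add: qform_def)
  moreover have "0 < qform A u"
    using u(1) by (intro pos) auto
  ultimately show ?thesis
    by blast
qed

text \<open>The dual, with respect to the trace pairing, of the map
  \<open>X \<mapsto> A X A\<^sup>T + B X B\<^sup>T\<close> that propagates the second-moment matrix of the state.\<close>

definition lyap_step :: "real^'n^'n \<Rightarrow> real^'n^'n \<Rightarrow> real^'n^'n \<Rightarrow> real^'n^'n" where
  "lyap_step A B S = transpose A ** S ** A + transpose B ** S ** B"

lemma qform_lyap_step: "qform (lyap_step A B S) v = qform S (A *v v) + qform S (B *v v)"
  by (simp add: lyap_step_def qform_add qform_congruence)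

lemma lyap_step_add: "lyap_step A B (S + T) = lyap_step A B S + lyap_step A B T"
  unfolding lyap_step_def matrix_eq matrix_vector_mul_assoc[symmetric]
  by (simp only: matrix_vector_mult_add_rdistrib matrix_vector_right_distrib
      matrix_vector_mul_assoc[symmetric] add_ac simp_thms)

text \<open>\<open>pull_back F G k i S\<close> represents the conditional mean of the form \<open>S\<close> at time \<open>k + i\<close> as a
  form in the state at time \<open>k\<close>. The recursion removes the latest time step first, which is the
  order in which the trajectory itself is built; inductions therefore keep the initial
  time fixed and generalize over \<open>S\<close>.\<close>

primrec pull_back :: "(nat \<Rightarrow> real^'n^'n) \<Rightarrow> (nat \<Rightarrow> real^'n^'n) \<Rightarrow> nat \<Rightarrow> nat \<Rightarrow> real^'n^'n \<Rightarrow> real^'n^'n"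
  where
    "pull_back F G k 0 S = S"
  | "pull_back F G k (Suc i) S = pull_back F G k i (lyap_step (F (k + i)) (G (k + i)) S)"

lemma pull_back_add: "pull_back F G k i (S + T) = pull_back F G k i S + pull_back F G k i T"
  by (induction i arbitrary: S T) (simp_all add: lyap_step_add)

lemma qform_pull_back_nonneg:
  assumes "\<And>v. 0 \<le> qform S v"
  shows "0 \<le> qform (pull_back F G k i S) v"
  using assms
proof (induction i arbitrary: S)
  case (Suc i)
  show ?case
    unfolding pull_back.simps by (rule Suc.IH) (simp add: qform_lyap_step Suc.prems)
qed simp

lemma pull_back_periodic:
  assumes "\<And>k. F (k + \<tau>) = F k" "\<And>k. G (k + \<tau>) = G k"
  shows "pull_back F G (k + \<tau>) i S = pull_back F G k i S"
proof (induction i arbitrary: S)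
  case (Suc i)
  have "F (k + \<tau> + i) = F (k + i)" "G (k + \<tau> + i) = G (k + i)"
    using assms[of "k + i"] by (simp_all add: add_ac)
  with Suc show ?case
    by simp
qed simp

definition gramian ::
    "(nat \<Rightarrow> real^'n^'n) \<Rightarrow> (nat \<Rightarrow> real^'n^'n) \<Rightarrow> (nat \<Rightarrow> real^'n^'m) \<Rightarrow> nat \<Rightarrow> nat \<Rightarrow> real^'n^'n" where
  "gramian F G H k m = (\<Sum>i<m. pull_back F G k i (transpose (H (k + i)) ** H (k + i)))"

lemma qform_gramian_nonneg: "0 \<le> qform (gramian F G H k m) v"
  unfolding gramian_def qform_sum
  by (intro sum_nonneg qform_pull_back_nonneg) (simp add: qform_gram)

lemma gramian_mod_period:
  assumes "\<And>k. F (k + \<tau>) = F k" "\<And>k. G (k + \<tau>) = G k" "\<And>k. H (k + \<tau>) = H k"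
  shows "gramian F G H (k mod \<tau>) m = gramian F G H k m"
proof -
  have shift: "gramian F G H (k + \<tau>) m = gramian F G H k m" for k
  proof -
    have "H (k + \<tau> + i) = H (k + i)" for i
      using assms(3)[of "k + i"] by (simp add: add_ac)
    then show ?thesis
      unfolding gramian_def by (simp add: pull_back_periodic[of F \<tau> G, OF assms(1,2)])
  qed
  have "gramian F G H (k mod \<tau> + j * \<tau>) m = gramian F G H (k mod \<tau>) m" for j
  proof (induction j)
    case (Suc j)
    have "k mod \<tau> + Suc j * \<tau> = (k mod \<tau> + j * \<tau>) + \<tau>"
      by simp
    then show ?case
      using shift Suc by metis
  qed simp
  from this[of "k div \<tau>"] show ?thesis
    by simp
qed

text \<open>The equation reads \<open>P\<^sub>j = H\<^sub>j\<^sup>T H\<^sub>j + lyap_step F\<^sub>j G\<^sub>j P\<^sub>j\<^sub>+\<^sub>1\<close>; substituting it into its own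
  right-hand side \<open>m\<close> times produces the observability Gramian and one remainder.\<close>

lemma GLE_telescope:
  assumes "solves_GLE F G H P"
  shows "P k = gramian F G H k m + pull_back F G k m (P (k + m))"
proof (induction m)
  case (Suc m)
  have "P (k + m) = transpose (H (k + m)) ** H (k + m) + lyap_step (F (k + m)) (G (k + m)) (P (k + Suc m))"
    using assms[unfolded solves_GLE_def, rule_format, of "k + m"]
    by (simp add: lyap_step_def algebra_simps add_eq_0_iff)
  with Suc show ?case
    by (simp add: gramian_def pull_back_add add.assoc)
qed (simp add: gramian_def)

lemma gramian_le_GLE_solution:
  assumes "solves_GLE F G H P" and "\<And>k. psd (P k)"
  shows "qform (gramian F G H k m) v \<le> qform (P k) v"
proof -
  have "0 \<le> qform (pull_back F G k m (P (k + m))) v"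
    using assms(2) by (intro qform_pull_back_nonneg) (simp add: psd_def qform_def)
  then show ?thesis
    using GLE_telescope[OF assms(1), of k m] by (simp add: qform_add)
qed

section \<open>White noise and the past\<close>

lemma space_noise_filtration [simp]: "space (noise_filtration M w k) = space M"
  by (simp add: noise_filtration_def space_measure_of_conv)

lemma sets_noise_filtration:
  "sets (noise_filtration M w k) =
     sigma_sets (space M) (\<Union>j\<in>{j. int j \<le> k}. {w j -` A \<inter> space M | A. A \<in> sets borel})"
  unfolding noise_filtration_def by (rule sets_measure_of) auto

lemma sets_noise_filtration_mono:
  "k \<le> l \<Longrightarrow> sets (noise_filtration M w k) \<subseteq> sets (noise_filtration M w l)"
  unfolding sets_noise_filtration by (intro sigma_sets_mono' UN_mono) auto

lemma measurable_noise_filtration_mono: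
  assumes "x \<in> measurable (noise_filtration M w k) N" "k \<le> l"
  shows "x \<in> measurable (noise_filtration M w l) N"
  using assms(1) sets_noise_filtration_mono[OF assms(2)]
  unfolding measurable_def space_noise_filtration by blast

lemma noise_measurable_noise_filtration:
  "w k \<in> borel_measurable (noise_filtration M w (int k))"
proof (rule measurableI)
  fix A :: "real set"
  assume "A \<in> sets borel"
  then show "w k -` A \<inter> space (noise_filtration M w (int k)) \<in> sets (noise_filtration M w (int k))"
    unfolding space_noise_filtration sets_noise_filtration by (intro sigma_sets.Basic UN_I[of k]) auto
qed simp

context prob_space
begin

lemma white_noise_random_variable:
  "white_noise M w \<Longrightarrow> random_variable borel (w k)"
  by (auto simp: white_noise_def indep_vars_def2)

lemma sets_noise_filtration_subset:
  assumes "white_noise M w"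
  shows "sets (noise_filtration M w k) \<subseteq> events"
  unfolding sets_noise_filtration
  using white_noise_random_variable[OF assms]
  by (intro sets.sigma_sets_subset) (auto simp: measurable_sets)

lemma random_variable_of_noise_filtration:
  assumes "white_noise M w" "x \<in> measurable (noise_filtration M w k) N"
  shows "random_variable N x"
  using assms(2) sets_noise_filtration_subset[OF assms(1), of k]
  unfolding measurable_def space_noise_filtration by blast

text \<open>Independence of the family \<open>w\<close> passes to the sigma-algebras generated by disjoint blocks of
  it, here the block of all \<open>w\<^sub>j\<close> with \<open>j < k\<close> and the block consisting of \<open>w\<^sub>k\<close>.\<close>

lemma indep_var_past_noise:
  fixes Z :: "'a \<Rightarrow> real"
  assumes w: "white_noise M w"
    and Z: "Z \<in> borel_measurable (noise_filtration M w (int k - 1))"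
  shows "indep_var borel Z borel (w k)"
proof -
  let ?E = "\<lambda>j. {w j -` A \<inter> space M | A. A \<in> sets (borel :: real measure)}"
  let ?I = "case_bool {j. int j \<le> int k - 1} {k}"
  have E: "indep_sets ?E UNIV"
    using w by (auto simp: white_noise_def indep_vars_def2)
  have "indep_sets (\<lambda>b. sigma_sets (space M) (\<Union>j\<in>?I b. ?E j)) UNIV"
  proof (rule indep_sets_collect_sigma)
    show "indep_sets ?E (\<Union>b\<in>UNIV. ?I b)"
      by (rule indep_sets_mono_index[OF _ E]) simp
    show "Int_stable (?E j)" for j
    proof (rule Int_stableI)
      fix a b assume "a \<in> ?E j" "b \<in> ?E j"
      then obtain A B where "a = w j -` A \<inter> space M" "b = w j -` B \<inter> space M"
          "A \<in> sets borel" "B \<in> sets borel"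
        by blast
      then have "a \<inter> b = w j -` (A \<inter> B) \<inter> space M" "A \<inter> B \<in> sets borel"
        by auto
      then show "a \<inter> b \<in> ?E j"
        by blast
    qed
    show "disjoint_family_on ?I UNIV"
      by (auto simp: disjoint_family_on_def split: bool.splits)
  qed
  then have "indep_set (sets (noise_filtration M w (int k - 1))) (sigma_sets (space M) (?E k))"
    unfolding indep_set_def sets_noise_filtration
    by (rule indep_sets_mono_sets) (auto split: bool.splits)
  moreover have "sigma_sets (space M) {Z -` A \<inter> space M | A. A \<in> sets borel}
      \<subseteq> sets (noise_filtration M w (int k - 1))"
    using measurable_sets[OF Z]
    by (intro sets.sigma_sets_subset[of _ "noise_filtration M w (int k - 1)", simplified]) auto
  ultimately have "indep_set (sigma_sets (space M) {Z -` A \<inter> space M | A. A \<in> sets borel})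
      (sigma_sets (space M) (?E k))"
    unfolding indep_sets2_eq by blast
  then show ?thesis
    unfolding indep_var_eq
    using white_noise_random_variable[OF w] random_variable_of_noise_filtration[OF w Z] by blast
qed

lemma noise_times_past:
  fixes Z :: "'a \<Rightarrow> real"
  assumes w: "white_noise M w"
    and Z: "Z \<in> borel_measurable (noise_filtration M w (int k - 1))" "integrable M Z"
  shows "integrable M (\<lambda>\<omega>. Z \<omega> * w k \<omega>)" "expectation (\<lambda>\<omega>. Z \<omega> * w k \<omega>) = 0"
    and "integrable M (\<lambda>\<omega>. Z \<omega> * (w k \<omega>)\<^sup>2)"
    and "expectation (\<lambda>\<omega>. Z \<omega> * (w k \<omega>)\<^sup>2) = expectation Z"
proof -
  have sq: "integrable M (\<lambda>\<omega>. (w k \<omega>)\<^sup>2)" and mean: "expectation (w k) = 0"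
    and "expectation (\<lambda>\<omega>. w k \<omega> * w k \<omega>) = 1"
    using w by (auto simp: white_noise_def)
  then have var: "expectation (\<lambda>\<omega>. (w k \<omega>)\<^sup>2) = 1"
    by (simp add: power2_eq_square)
  have int: "integrable M (w k)"
    using white_noise_random_variable[OF w] sq by (rule square_integrable_imp_integrable)
  have ind: "indep_var borel Z borel (w k)"
    using w Z(1) by (rule indep_var_past_noise)
  then have ind2: "indep_var borel Z borel (\<lambda>\<omega>. (w k \<omega>)\<^sup>2)"
    using indep_var_compose[OF ind, of id borel "\<lambda>x. x\<^sup>2" borel] by (simp add: o_def)
  show "integrable M (\<lambda>\<omega>. Z \<omega> * w k \<omega>)" "expectation (\<lambda>\<omega>. Z \<omega> * w k \<omega>) = 0"
    using indep_var_integrable[OF ind Z(2) int] indep_var_lebesgue_integral[OF ind Z(2) int] mean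
    by simp_all
  show "integrable M (\<lambda>\<omega>. Z \<omega> * (w k \<omega>)\<^sup>2)"
    "expectation (\<lambda>\<omega>. Z \<omega> * (w k \<omega>)\<^sup>2) = expectation Z"
    using indep_var_integrable[OF ind2 Z(2) sq] indep_var_lebesgue_integral[OF ind2 Z(2) sq] var
    by simp_all
qed

section \<open>Second moments along trajectories\<close>

lemma integrable_qform:
  assumes "white_noise M w" "x \<in> l2_adapted M w k"
  shows "integrable M (\<lambda>\<omega>. qform A (x \<omega>))"
proof -
  obtain K where K: "\<And>v. \<bar>qform A v\<bar> \<le> K * (norm v)\<^sup>2"
    using qform_bounded by blast
  have [measurable]: "random_variable borel x"
    using assms random_variable_of_noise_filtration by (auto simp: l2_adapted_def)
  show ?thesis
  proof (rule Bochner_Integration.integrable_bound)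
    show "integrable M (\<lambda>\<omega>. K * (norm (x \<omega>))\<^sup>2)"
      using assms(2) by (auto simp: l2_adapted_def)
    show "AE \<omega> in M. norm (qform A (x \<omega>)) \<le> norm (K * (norm (x \<omega>))\<^sup>2)"
      using K by (intro AE_I2) (metis abs_ge_self order_trans real_norm_def)
  qed measurable
qed

text \<open>The expansion in powers of the noise value \<open>r\<close> isolates the cross term, which vanishes in
  mean, and the square term, whose noise factor has mean one.\<close>

lemma qform_step:
  fixes A B S :: "real^'n^'n"
  shows "qform S (A *v v + r *\<^sub>R (B *v v)) = qform (transpose A ** S ** A) v
    + qform (transpose A ** S ** B + transpose B ** S ** A) v * r + qform (transpose B ** S ** B) v * r\<^sup>2"
proof -
  have cross: "qform (transpose C ** S ** D) v = (C *v v) \<bullet> (S *v (D *v v))" for C D :: "real^'n^'n"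
    unfolding qform_def by (simp only: matrix_vector_mul_assoc[symmetric] inner_transpose_matrix_vector)
  show ?thesis
    unfolding qform_add cross
    by (simp add: qform_def matrix_vector_right_distrib matrix_vector_mult_scaleR inner_add_right
        inner_add_left power2_eq_square algebra_simps del: matrix_vector_mul_assoc)
qed

lemma step_l2_adapted:
  fixes A B S :: "real^'n^'n"
  assumes w: "white_noise M w" and x: "x \<in> l2_adapted M w (int k - 1)"
  defines "x' \<equiv> \<lambda>\<omega>. A *v x \<omega> + w k \<omega> *\<^sub>R (B *v x \<omega>)"
  shows "x' \<in> l2_adapted M w (int k)"
    and "expectation (\<lambda>\<omega>. qform S (x' \<omega>)) = expectation (\<lambda>\<omega>. qform (lyap_step A B S) (x \<omega>))"
proof -
  have x_meas: "x \<in> borel_measurable (noise_filtration M w (int k - 1))"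
    using x by (simp add: l2_adapted_def)
  have q_meas: "(\<lambda>\<omega>. qform T (x \<omega>)) \<in> borel_measurable (noise_filtration M w (int k - 1))" for T
    using x_meas by measurable
  note noise = noise_times_past[OF w q_meas integrable_qform[OF w x]]
  have int: "integrable M (\<lambda>\<omega>. qform T (x' \<omega>))" for T
    unfolding x'_def qform_step
    by (intro Bochner_Integration.integrable_add noise integrable_qform[OF w x])
  have "x' \<in> borel_measurable (noise_filtration M w (int k))"
  proof -
    have [measurable]: "x \<in> borel_measurable (noise_filtration M w (int k))"
      using x_meas by (rule measurable_noise_filtration_mono) simp
    have [measurable]: "w k \<in> borel_measurable (noise_filtration M w (int k))"
      by (rule noise_measurable_noise_filtration)
    have [measurable]: "(*v) C \<in> borel_measurable borel" for C :: "real^'n^'n"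
      by (intro borel_measurable_continuous_onI linear_continuous_on matrix_vector_mul_bounded_linear)
    show ?thesis
      unfolding x'_def by measurable
  qed
  with int[of "mat 1"] show "x' \<in> l2_adapted M w (int k)"
    by (simp add: l2_adapted_def qform_mat_1)
  show "expectation (\<lambda>\<omega>. qform S (x' \<omega>)) = expectation (\<lambda>\<omega>. qform (lyap_step A B S) (x \<omega>))"
    unfolding x'_def qform_step lyap_step_def qform_add[of "transpose A ** S ** A"]
    by (simp add: noise integrable_qform[OF w x])
qed

lemma trajectory_start [simp]: "k \<le> k0 \<Longrightarrow> trajectory F G w k0 x k = x"
  by (induction k) auto

text \<open>Any later state can serve as a new initial state; this carries bounds in terms of the
  initial state over to every time \<open>k0 + i\<close>.\<close>

lemma trajectory_restart:
  "trajectory F G w (k0 + i) (trajectory F G w k0 x (k0 + i)) (k0 + i + j) = trajectory F G w k0 x (k0 + i + j)"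
  by (induction j) auto

lemma trajectory_l2_adapted:
  assumes w: "white_noise M w" and x: "x \<in> l2_adapted M w (int k0 - 1)"
  shows "trajectory F G w k0 x (k0 + i) \<in> l2_adapted M w (int (k0 + i) - 1)"
proof (induction i)
  case (Suc i)
  from step_l2_adapted(1)[OF w Suc] show ?case
    by simp
qed (use x in simp)

lemma expectation_qform_trajectory:
  assumes w: "white_noise M w" and x: "x \<in> l2_adapted M w (int k0 - 1)"
  shows "expectation (\<lambda>\<omega>. qform S (trajectory F G w k0 x (k0 + i) \<omega>))
    = expectation (\<lambda>\<omega>. qform (pull_back F G k0 i S) (x \<omega>))"
proof (induction i arbitrary: S)
  case (Suc i)
  from step_l2_adapted(2)[OF w trajectory_l2_adapted[OF w x, of F G i]] Suc show ?case
    by simp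
qed simp

lemma output_energy:
  assumes w: "white_noise M w" and x: "x \<in> l2_adapted M w (int k0 - 1)"
  shows "(\<Sum>i<m. expectation (\<lambda>\<omega>. (norm (H (k0 + i) *v trajectory F G w k0 x (k0 + i) \<omega>))\<^sup>2))
    = expectation (\<lambda>\<omega>. qform (gramian F G H k0 m) (x \<omega>))"
  unfolding gramian_def qform_sum
  by (subst Bochner_Integration.integral_sum)
     (simp_all add: integrable_qform[OF w x] expectation_qform_trajectory[OF w x] flip: qform_gram)

text \<open>A deterministic initial state is adapted at every time. If the Gramian form vanishes at it,
  then each of the \<open>N + 1\<close> nonnegative output energies has mean zero, so all these outputs vanish
  almost surely and observability forces the state to be zero.\<close>

lemma gramian_pos_of_exactly_observable:
  assumes w: "white_noise M w" and obs: "exactly_observable_at M w F G H k N" and v: "v \<noteq> 0"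
  shows "0 < qform (gramian F G H k (Suc N)) v"
proof (rule ccontr)
  assume "\<not> ?thesis"
  then have zero: "qform (gramian F G H k (Suc N)) v = 0"
    using qform_gramian_nonneg[of F G H k "Suc N" v] by linarith
  have x: "(\<lambda>_. v) \<in> l2_adapted M w (int k - 1)"
    by (simp add: l2_adapted_def)
  define y where "y i \<omega> = H (k + i) *v trajectory F G w k (\<lambda>_. v) (k + i) \<omega>" for i \<omega>
  have int: "integrable M (\<lambda>\<omega>. (norm (y i \<omega>))\<^sup>2)" for i
    using integrable_qform[OF w trajectory_l2_adapted[OF w x, of F G i],
        of "transpose (H (k + i)) ** H (k + i)"]
    by (simp add: y_def qform_gram)
  have "(\<Sum>i<Suc N. expectation (\<lambda>\<omega>. (norm (y i \<omega>))\<^sup>2)) = 0"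
    using output_energy[OF w x, of H F G "Suc N"] zero by (simp add: y_def)
  then have "\<forall>i\<in>{..<Suc N}. expectation (\<lambda>\<omega>. (norm (y i \<omega>))\<^sup>2) = 0"
    by (subst (asm) sum_nonneg_eq_0_iff) auto
  then have y0: "AE \<omega> in M. y i \<omega> = 0" if "i \<le> N" for i
    using that integral_nonneg_eq_0_iff_AE[OF int[of i]] by (auto simp: less_Suc_eq_le)
  have "unobservable_state M w F G H k N (\<lambda>_. v)"
    unfolding unobservable_state_def
  proof (intro conjI x ballI)
    fix l assume "l \<in> {k..k + N}"
    then have "l = k + (l - k)" "l - k \<le> N"
      by auto
    with y0[of "l - k"] show "AE \<omega> in M. H l *v trajectory F G w k (\<lambda>_. v) l \<omega> = 0"
      by (simp add: y_def)
  qed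
  with obs x have "AE \<omega> in M. v = 0"
    by (auto simp: exactly_observable_at_def)
  with v show False
    by simp
qed

end

section \<open>Uniform bounds over a period\<close>

text \<open>Each Gramian is replaced by the one with initial time \<open>k mod \<tau>\<close> before it is compared with
  the Lyapunov solution. Thus a maximum over one period bounds them all, even when
  \<open>P\<close> is unbounded.\<close>

lemma periodic_gramian_upper_bound:
  assumes per: "\<tau> > 0" "\<And>k. F (k + \<tau>) = F k" "\<And>k. G (k + \<tau>) = G k" "\<And>k. H (k + \<tau>) = H k"
    and P: "solves_GLE F G H P" "\<And>k. psd (P k)"
  shows "\<exists>C>0. \<forall>k m v. qform (gramian F G H k m) v \<le> C * (norm v)\<^sup>2"
proof -
  have "\<exists>K. \<forall>k. 0 < K k \<and> (\<forall>v. \<bar>qform (P k) v\<bar> \<le> K k * (norm v)\<^sup>2)"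
    using qform_bounded by (intro choice) blast
  then obtain K where K: "\<And>k. 0 < K k" "\<And>k v. \<bar>qform (P k) v\<bar> \<le> K k * (norm v)\<^sup>2"
    by blast
  define C where "C = Max (K ` {..<\<tau>})"
  have K_le: "K (k mod \<tau>) \<le> C" for k
    unfolding C_def using per(1) by (intro Max_ge) auto
  have "qform (gramian F G H k m) v \<le> C * (norm v)\<^sup>2" for k m v
  proof -
    have "qform (gramian F G H k m) v = qform (gramian F G H (k mod \<tau>) m) v"
      by (simp add: gramian_mod_period[of F \<tau> G H, OF per(2-4)])
    also have "\<dots> \<le> qform (P (k mod \<tau>)) v"
      using P by (rule gramian_le_GLE_solution)
    also have "\<dots> \<le> K (k mod \<tau>) * (norm v)\<^sup>2"
      using K(2)[of "k mod \<tau>" v] by linarith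
    also have "\<dots> \<le> C * (norm v)\<^sup>2"
      using K_le by (intro mult_right_mono) auto
    finally show ?thesis .
  qed
  moreover have "0 < C"
    using K(1)[of "0 mod \<tau>"] K_le[of 0] by linarith
  ultimately show ?thesis
    by blast
qed

lemma periodic_gramian_lower_bound:
  assumes per: "\<tau> > 0" "\<And>k. F (k + \<tau>) = F k" "\<And>k. G (k + \<tau>) = G k" "\<And>k. H (k + \<tau>) = H k"
    and pos: "\<And>k v. v \<noteq> 0 \<Longrightarrow> 0 < qform (gramian F G H k m) v"
  shows "\<exists>c>0. \<forall>k v. c * (norm v)\<^sup>2 \<le> qform (gramian F G H k m) v"
proof -
  have "\<exists>K. \<forall>k. 0 < K k \<and> (\<forall>v. K k * (norm v)\<^sup>2 \<le> qform (gramian F G H k m) v)"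
    using qform_coercive pos by (intro choice) blast
  then obtain K where K: "\<And>k. 0 < K k" "\<And>k v. K k * (norm v)\<^sup>2 \<le> qform (gramian F G H k m) v"
    by blast
  define c where "c = Min (K ` {..<\<tau>})"
  have le_K: "c \<le> K (k mod \<tau>)" for k
    unfolding c_def using per(1) by (intro Min_le) auto
  have "c * (norm v)\<^sup>2 \<le> qform (gramian F G H k m) v" for k v
  proof -
    have "c * (norm v)\<^sup>2 \<le> K (k mod \<tau>) * (norm v)\<^sup>2"
      using le_K by (intro mult_right_mono) auto
    also have "\<dots> \<le> qform (gramian F G H (k mod \<tau>) m) v"
      by (rule K)
    also have "\<dots> = qform (gramian F G H k m) v"
      by (simp add: gramian_mod_period[of F \<tau> G H, OF per(2-4)])
    finally show ?thesis .
  qed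
  moreover have "0 < c"
    unfolding c_def using per(1) K(1) by (subst Min_gr_iff) auto
  ultimately show ?thesis
    by blast
qed

section \<open>Exponential stability\<close>

text \<open>After exchanging the sums over the starting point \<open>i\<close> of a window and the offset \<open>j\<close> in it,
  each of the \<open>n\<close> offsets contributes a shifted part of the total energy after time \<open>s\<close>.\<close>

lemma tail_sums_le_of_windows:
  fixes a h :: "nat \<Rightarrow> real"
  assumes c: "0 < c" and h: "\<And>i. 0 \<le> h i"
    and window: "\<And>s. c * a s \<le> (\<Sum>j<n. h (s + j))"
    and total: "\<And>s m. (\<Sum>j<m. h (s + j)) \<le> C * a s"
  shows "(\<Sum>i<m. a (s + i)) \<le> n * C / c * a s"
proof -
  have "c * (\<Sum>i<m. a (s + i)) \<le> (\<Sum>i<m. \<Sum>j<n. h (s + i + j))"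
    unfolding sum_distrib_left by (intro sum_mono window)
  also have "\<dots> = (\<Sum>j<n. \<Sum>i<m. h (s + i + j))"
    by (rule sum.swap)
  also have "\<dots> \<le> (\<Sum>j<n. \<Sum>i<m + n. h (s + i))"
  proof (rule sum_mono)
    fix j assume "j \<in> {..<n}"
    then have "(\<lambda>i. i + j) ` {..<m} \<subseteq> {..<m + n}"
      by auto
    moreover have "(\<Sum>i<m. h (s + i + j)) = (\<Sum>i\<in>(\<lambda>i. i + j) ` {..<m}. h (s + i))"
      by (subst sum.reindex) (auto simp: add.assoc)
    ultimately show "(\<Sum>i<m. h (s + i + j)) \<le> (\<Sum>i<m + n. h (s + i))"
      using h by (auto intro!: sum_mono2)
  qed
  also have "\<dots> \<le> n * (C * a s)"
    using total[where s = s and m = "m + n"] by (simp add: mult_left_mono)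
  finally show ?thesis
    using c by (simp add: field_simps)
qed

theorem theorem4p3:
  fixes M :: "'a measure"
    and w :: "nat \<Rightarrow> 'a \<Rightarrow> real"
    and F G P :: "nat \<Rightarrow> real^'n^'n"
    and H :: "nat \<Rightarrow> real^'n^'m"
    and \<tau> N :: nat
  assumes "prob_space M"
    and "white_noise M w"
    and "\<tau> > 0"
    and "\<And>k. F (k + \<tau>) = F k"
    and "\<And>k. G (k + \<tau>) = G k"
    and "\<And>k. H (k + \<tau>) = H k"
    and "K_exactly_observable M w F G H N"
    and "\<And>k. psd (P k)"
    and "solves_GLE F G H P"
  shows "ESMS M w F G"
proof -
  interpret prob_space M
    by fact
  note w = assms(2)
  obtain C where C: "C > 0" "\<And>k m v. qform (gramian F G H k m) v \<le> C * (norm v)\<^sup>2"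
    using periodic_gramian_upper_bound[of \<tau> F G H P] assms(3-6,8,9) by metis
  have "0 < qform (gramian F G H k (Suc N)) v" if "v \<noteq> 0" for k v
    using assms(7) by (intro gramian_pos_of_exactly_observable[OF w _ that])
      (simp add: K_exactly_observable_def)
  then obtain c where c: "c > 0" "\<And>k v. c * (norm v)\<^sup>2 \<le> qform (gramian F G H k (Suc N)) v"
    using periodic_gramian_lower_bound[of \<tau> F G H "Suc N"] assms(3-6) by metis
  \<comment> \<open>The summand 1 only serves to make the decay rate \<open>1 - 1 / D\<close> strictly positive.\<close>
  define D where "D = 1 + Suc N * C / c"
  have D: "1 < D"
    unfolding D_def using C(1) c(1) by simp
  have decay: "integrable M (\<lambda>\<omega>. (norm (trajectory F G w k0 x (k0 + i) \<omega>))\<^sup>2) \<and>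
      expectation (\<lambda>\<omega>. (norm (trajectory F G w k0 x (k0 + i) \<omega>))\<^sup>2)
        \<le> D * expectation (\<lambda>\<omega>. (norm (x \<omega>))\<^sup>2) * (1 - 1 / D) ^ i"
    if x: "x \<in> l2_adapted M w (int k0 - 1)" for k0 i x
  proof -
    define X where "X i = trajectory F G w k0 x (k0 + i)" for i
    define a where "a i = expectation (\<lambda>\<omega>. (norm (X i \<omega>))\<^sup>2)" for i
    define h where "h i = expectation (\<lambda>\<omega>. (norm (H (k0 + i) *v X i \<omega>))\<^sup>2)" for i
    have X: "X i \<in> l2_adapted M w (int (k0 + i) - 1)" for i
      unfolding X_def using w x by (rule trajectory_l2_adapted)
    then have int: "integrable M (\<lambda>\<omega>. (norm (X i \<omega>))\<^sup>2)" for i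
      by (simp add: l2_adapted_def)
    have energy: "(\<Sum>j<m. h (s + j)) = expectation (\<lambda>\<omega>. qform (gramian F G H (k0 + s) m) (X s \<omega>))" for s m
      using output_energy[OF w X[of s], of H F G m]
      by (simp add: h_def X_def trajectory_restart add.assoc[symmetric])
    have "c * a s \<le> (\<Sum>j<Suc N. h (s + j))" for s
      unfolding energy a_def integral_mult_right_zero[symmetric]
      by (intro integral_mono c integrable_qform[OF w X] integrable_mult_right int)
    moreover have "(\<Sum>j<m. h (s + j)) \<le> C * a s" for s m
      unfolding energy a_def integral_mult_right_zero[symmetric]
      by (intro integral_mono C integrable_qform[OF w X] integrable_mult_right int)
    moreover have "0 \<le> h i" "0 \<le> a i" for i
      by (simp_all add: h_def a_def)
    ultimately have "(\<Sum>i<m. a (s + i)) \<le> Suc N * C / c * a s" for s m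
      using c(1) by (intro tail_sums_le_of_windows[where h = h])
    then have "(\<Sum>i<m. a (s + i)) \<le> D * a s" for s m
      using \<open>\<And>i. 0 \<le> a i\<close> by (fastforce simp: D_def distrib_right intro: add_increasing)
    then have "a i \<le> D * a 0 * (1 - 1 / D) ^ i"
      using D \<open>\<And>i. 0 \<le> a i\<close> by (intro exponential_decay_of_tail_sums_le)
    with int[of i] show ?thesis
      by (simp add: a_def X_def)
  qed
  show ?thesis
    unfolding ESMS_def
  proof (intro exI conjI allI impI ballI)
    show "1 \<le> D" "0 < 1 - 1 / D" "1 - 1 / D < 1"
      using D by auto
    fix k0 k :: nat and x :: "'a \<Rightarrow> real^'n"
    assume "k0 \<le> k" and x: "x \<in> l2_adapted M w (int k0 - 1)"
    then show "integrable M (\<lambda>\<omega>. (norm (trajectory F G w k0 x k \<omega>))\<^sup>2)"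
      and "expectation (\<lambda>\<omega>. (norm (trajectory F G w k0 x k \<omega>))\<^sup>2)
        \<le> D * expectation (\<lambda>\<omega>. (norm (x \<omega>))\<^sup>2) * (1 - 1 / D) ^ (k - k0)"
      using decay[OF x, of "k - k0"] by simp_all
  qed
qed

end
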